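(* Let $k$ be a positive integer. The minimum cost of a $k$-solvable natural test is $$Q_k=\frac{k(k+1)(2k+1)}{6}.$$
   Context: A natural test is a finite multiset of positive integers (its answers; order is irrelevant). The cost of a test is the sum of all its answers with multiplicity. A positive integer $a$ is a valid answer of a natural test if $a$ appears in the test exactly $a$ times. A test is $k$-solvable if it has exactly $k$ distinct valid answers. *)

theory Defs
  imports Complex_Main "HOL-Library.Multiset"
begin

definition natural_test :: "nat multiset \<Rightarrow> bool" where
  "natural_test T \<longleftrightarrow> (\<forall>a \<in># T. 0 < a)"

definition cost :: "nat multiset \<Rightarrow> nat" where
  "cost T = sum_mset T"

text \<open>Positivity is required explicitly: 0 does not occur in a natural test, so the
  condition \<open>count T a = a\<close> alone would also hold for \<open>a = 0\<close>.\<close>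

definition valid_answer :: "nat multiset \<Rightarrow> nat \<Rightarrow> bool" where
  "valid_answer T a \<longleftrightarrow> 0 < a \<and> count T a = a"

definition solvable :: "nat \<Rightarrow> nat multiset \<Rightarrow> bool" where
  "solvable k T \<longleftrightarrow> card {a. valid_answer T a} = k"

end

theory Submission
  imports Defs
begin

text \<open>Grouping equal answers writes the cost of a test \<open>T\<close> as \<open>\<Sum>a. count T a * a\<close>, so a valid
  answer \<open>a\<close> alone contributes \<open>a\<^sup>2\<close>. A \<open>k\<close>-solvable test therefore costs at least the sum of
  the squares of \<open>k\<close> distinct positive integers, and such a sum is least for \<open>1, \<dots>, k\<close>
  (\<open>sum_initial_segment_le\<close>). The test in which each of \<open>1, \<dots>, k\<close> is repeated as often as its
  value says, and nothing else occurs, attains this bound.\<close>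

lemma six_times_sum_of_squares:
  "6 * (\<Sum>i=1..k. i\<^sup>2) = k * (k + 1) * (2 * k + 1)" for k :: nat
  by (induction k) (simp_all add: algebra_simps power2_eq_square)

text \<open>The largest of \<open>n\<close> distinct positive integers is at least \<open>n\<close>; removing it leaves a set to
  which induction applies.\<close>

lemma sum_initial_segment_le:
  fixes f :: "nat \<Rightarrow> 'b::ordered_comm_monoid_add"
  assumes "mono f" "finite A" "0 \<notin> A"
  shows "(\<Sum>i=1..card A. f i) \<le> (\<Sum>a\<in>A. f a)"
  using assms(2,3)
proof (induction A rule: finite_linorder_max_induct)
  case empty
  then show ?case by simp
next
  case (insert b A)
  then have "b \<notin> A" by blast
  have "insert b A \<subseteq> {1..b}"
    using insert.hyps(2) insert.prems by (fastforce simp: Suc_le_eq intro: gr0I less_imp_le)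
  from card_mono[OF _ this] have "card (insert b A) \<le> b" by simp
  then have "f (card (insert b A)) \<le> f b"
    by (rule monoD[OF \<open>mono f\<close>])
  moreover have "(\<Sum>i=1..card A. f i) \<le> (\<Sum>a\<in>A. f a)"
    using insert.IH insert.prems by simp
  ultimately show ?case
    using insert.hyps(1) \<open>b \<notin> A\<close> by (simp add: add_mono add.commute)
qed

lemma cost_eq_sum_count: "cost T = (\<Sum>a\<in>set_mset T. count T a * a)"
proof -
  \<comment> \<open>Summing over a fixed finite superset of the support keeps the index set constant when an
    element is added.\<close>
  have "sum_mset S = (\<Sum>a\<in>B. count S a * a)" if "finite B" "set_mset S \<subseteq> B" for S B
    using that(2)
  proof (induction S)
    case (add x S)
    have "(\<Sum>a\<in>B. count (add_mset x S) a * a) = (\<Sum>a\<in>B. (if a = x then x else 0) + count S a * a)"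
      by (rule sum.cong) auto
    also have "\<dots> = x + (\<Sum>a\<in>B. count S a * a)"
      using that(1) add.prems by (simp add: sum.distrib)
    finally show ?case using add by simp
  qed simp
  then show ?thesis by (simp add: cost_def)
qed

lemma valid_answer_in_test: "valid_answer T a \<Longrightarrow> a \<in># T"
  by (metis valid_answer_def count_greater_zero_iff)

lemma sum_valid_squares_le_cost:
  "(\<Sum>a\<in>{a. valid_answer T a}. a\<^sup>2) \<le> cost T"
proof -
  have "(\<Sum>a\<in>{a. valid_answer T a}. a\<^sup>2) = (\<Sum>a\<in>{a. valid_answer T a}. count T a * a)"
    by (rule sum.cong) (auto simp: valid_answer_def power2_eq_square)
  also have "\<dots> \<le> cost T"
    unfolding cost_eq_sum_count by (rule sum_mono2) (auto intro: valid_answer_in_test)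
  finally show ?thesis .
qed

definition staircase_test :: "nat \<Rightarrow> nat multiset" where
  "staircase_test k = (\<Sum>i=1..k. replicate_mset i i)"

lemma count_staircase_test: "count (staircase_test k) a = (if a \<le> k then a else 0)"
  by (induction k) (auto simp: staircase_test_def)

lemma natural_staircase_test: "natural_test (staircase_test k)"
  by (auto simp: natural_test_def count_staircase_test simp flip: count_greater_zero_iff
      split: if_splits)

lemma solvable_staircase_test: "solvable k (staircase_test k)"
proof -
  have "{a. valid_answer (staircase_test k) a} = {1..k}"
    by (auto simp: valid_answer_def count_staircase_test split: if_splits)
  then show ?thesis by (simp add: solvable_def)
qed

lemma cost_staircase_test: "cost (staircase_test k) = (\<Sum>i=1..k. i\<^sup>2)"
  by (induction k) (simp_all add: cost_def staircase_test_def power2_eq_square)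

theorem corollary6:
  fixes k :: nat
  assumes "0 < k"
  shows "(\<exists>T. natural_test T \<and> solvable k T \<and>
            real (cost T) = real k * (real k + 1) * (2 * real k + 1) / 6) \<and>
         (\<forall>T. natural_test T \<and> solvable k T \<longrightarrow>
            real k * (real k + 1) * (2 * real k + 1) / 6 \<le> real (cost T))"
proof -
  have "6 * real (\<Sum>i=1..k. i\<^sup>2) = real (k * (k + 1) * (2 * k + 1))"
    by (simp only: six_times_sum_of_squares[symmetric] of_nat_mult of_nat_numeral)
  then have Q: "real k * (real k + 1) * (2 * real k + 1) / 6 = real (\<Sum>i=1..k. i\<^sup>2)"
    by (simp add: field_simps del: of_nat_sum)
  have "(\<Sum>i=1..k. i\<^sup>2) \<le> cost T" if "solvable k T" for T
  proof -
    let ?A = "{a. valid_answer T a}"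
    have "finite ?A"
      by (rule finite_subset[OF _ finite_set_mset]) (auto intro: valid_answer_in_test)
    moreover have "0 \<notin> ?A"
      by (simp add: valid_answer_def)
    moreover have "mono (\<lambda>i::nat. i\<^sup>2)"
      by (simp add: mono_def power_mono)
    ultimately have "(\<Sum>i=1..card ?A. i\<^sup>2) \<le> (\<Sum>a\<in>?A. a\<^sup>2)"
      by (intro sum_initial_segment_le)
    with that sum_valid_squares_le_cost[of T] show ?thesis
      by (simp add: solvable_def)
  qed
  then show ?thesis
    unfolding Q of_nat_eq_iff of_nat_le_iff
    using natural_staircase_test solvable_staircase_test cost_staircase_test by blast
qed

end
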